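(* The graph bracket polynomial $[G]=[G](A,B,d)$ satisfies the following (identities of polynomials in $B,d$ and Laurent polynomials in $A$). (i) If $G$ is a finite graph with a loop at the vertex $a$, then $$[G]=A^{-1}B\,[G-\{a,a\}]+(A-A^{-1}B^{2})\,[G^{a}-a],$$ where $G-\{a,a\}$ is the graph obtained from $G$ by removing the loop at $a$. (ii) If $a$ and $b$ are distinct, adjacent, loopless vertices of a finite graph $G$, then $$[G]=A^{2}[G^{ab}-a-b]+AB\,[(G^{ab})^{a}-a-b]+B\,[G^{a}-a].$$ (iii) The empty graph $E_0$ (with no vertices) has $[E_0]=1$, and for every $n\ge 1$ the edgeless graph $E_n$ with $n$ vertices (no loops and no non-loop edges) has $[E_n]=(Ad+B)^n$.
   Context: Graphs are finite, undirected, may have loops (at most one per vertex), and have no multiple edges; the empty graph is allowed. For a graph $G$ with $V(G)=\{v_1,\dots,v_n\}$, the Boolean adjacency matrix $\mathcal{A}(G)=(a_{ij})$ is the $n\times n$ matrix over $GF(2)$ with $a_{ij}=1$ if and only if $\{v_i,v_j\}$ is an edge of $G$ (so $a_{ii}=1$ if and only if there is a loop at $v_i$). The graph bracket polynomial of $G$ is $$[G](A,B,d)=\sum_{\Delta}A^{\nu(\Delta)}B^{\rho(\Delta)}d^{\,\nu(\mathcal{A}(G)+\Delta)},$$ the sum being over all $n\times n$ diagonal matrices $\Delta$ over $GF(2)$, where $\nu$ and $\rho$ denote nullity and rank over $GF(2)$. It does not depend on the ordering of the vertices. Local complementation: for a vertex $a$ of $G$, $G^{a}$ is obtained from $G$ by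 toggling every adjacency $\{x,y\}$ such that $x\neq a\neq y$ and $x,y$ are both neighbors of $a$ in $G$ (the case $x=y$ is allowed, so that the loop status of each neighbor of $a$ other than $a$ is toggled). To toggle an adjacency means to insert the edge if it is absent and to remove it if it is present. Pivot: for distinct vertices $a,b$ of $G$, $G^{ab}$ is obtained from $G$ by toggling every adjacency $\{x,y\}$ such that $x,y\notin\{a,b\}$, $x$ is adjacent to $a$ in $G$, $y$ is adjacent to $b$ in $G$, and either $x$ is not adjacent to $b$ or $y$ is not adjacent to $a$ in $G$ (each such unordered pair is toggled once). For a graph $K$, $K-a$ (resp. $K-a-b$) is obtained by deleting the vertex $a$ (resp. the vertices $a$ and $b$) and all incident edges. *)

theory Defs
  imports
    "HOL-Library.Z2"
    "HOL-Library.Poly_Mapping"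
    "HOL-Library.Product_Plus"
    "Jordan_Normal_Form.Matrix_Kernel"
    "Jordan_Normal_Form.DL_Rank"
begin

(* An edge is the set {x, y} of its end points, so a loop at x is the singleton {x}. *)

record 'a graph =
  verts :: "'a set"
  edges :: "'a set set"

definition finite_graph :: "'a graph \<Rightarrow> bool" where
  "finite_graph G \<longleftrightarrow>
     finite (verts G) \<and> (\<forall>e\<in>edges G. \<exists>x\<in>verts G. \<exists>y\<in>verts G. e = {x, y})"

definition adj :: "'a graph \<Rightarrow> 'a \<Rightarrow> 'a \<Rightarrow> bool" where
  "adj G x y \<longleftrightarrow> {x, y} \<in> edges G"

definition edgeless_graph :: "'a set \<Rightarrow> 'a graph" where
  "edgeless_graph V = \<lparr>verts = V, edges = {}\<rparr>"

definition remove_loop :: "'a graph \<Rightarrow> 'a \<Rightarrow> 'a graph" where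
  "remove_loop G a = \<lparr>verts = verts G, edges = edges G - {{a, a}}\<rparr>"

definition delete_vertex :: "'a graph \<Rightarrow> 'a \<Rightarrow> 'a graph" where
  "delete_vertex G a = \<lparr>verts = verts G - {a}, edges = {e \<in> edges G. a \<notin> e}\<rparr>"

definition toggle :: "'a graph \<Rightarrow> 'a set set \<Rightarrow> 'a graph" where
  "toggle G T = \<lparr>verts = verts G, edges = (edges G - T) \<union> (T - edges G)\<rparr>"

definition local_compl :: "'a graph \<Rightarrow> 'a \<Rightarrow> 'a graph" where
  "local_compl G a =
     toggle G {{x, y} | x y. x \<noteq> a \<and> y \<noteq> a \<and> adj G x a \<and> adj G y a}"

definition pivot :: "'a graph \<Rightarrow> 'a \<Rightarrow> 'a \<Rightarrow> 'a graph" where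
  "pivot G a b =
     toggle G {{x, y} | x y. x \<notin> {a, b} \<and> y \<notin> {a, b} \<and> adj G x a \<and> adj G y b \<and>
                             (\<not> adj G x b \<or> \<not> adj G y a)}"

definition adj_mat :: "'a graph \<Rightarrow> 'a list \<Rightarrow> bit mat" where
  "adj_mat G vs =
     mat (length vs) (length vs) (\<lambda>(i, j). if adj G (vs ! i) (vs ! j) then 1 else 0)"

definition diagonal_mats :: "nat \<Rightarrow> bit mat set" where
  "diagonal_mats n = {D \<in> carrier_mat n n. diagonal_mat D}"

(* The ring Z[A, A^(-1), B, d], as the monoid ring of Int x Nat x Nat over the integers: the key
   (i, j, k) stands for the monomial A^i B^j d^k. *)

type_synonym laurent = "(int \<times> nat \<times> nat) \<Rightarrow>\<^sub>0 int"

definition var_A :: laurent where "var_A = Poly_Mapping.single (1, 0, 0) 1"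
definition inv_A :: laurent where "inv_A = Poly_Mapping.single (- 1, 0, 0) 1"
definition var_B :: laurent where "var_B = Poly_Mapping.single (0, 1, 0) 1"
definition var_d :: laurent where "var_d = Poly_Mapping.single (0, 0, 1) 1"

lemma var_A_inv_A: "var_A * inv_A = 1"
  by (simp add: var_A_def inv_A_def mult_single flip: single_one zero_prod_def)

(* The bracket computed with respect to the vertex ordering vs. *)
definition bracket_wrt :: "'a graph \<Rightarrow> 'a list \<Rightarrow> laurent" where
  "bracket_wrt G vs =
     (\<Sum>D\<in>diagonal_mats (length vs).
        var_A ^ kernel_dim D * var_B ^ vec_space.rank (length vs) D *
        var_d ^ kernel_dim (adj_mat G vs + D))"

(* The ordering is immaterial: reordering the vertices conjugates the adjacency matrix by a
   permutation matrix, and the same conjugation permutes the diagonal matrices. *)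
definition graph_bracket :: "'a graph \<Rightarrow> laurent" where
  "graph_bracket G = bracket_wrt G (SOME vs. distinct vs \<and> set vs = verts G)"

end

theory Submission
  imports Defs
begin

text \<open>
  The diagonal matrices over \<open>GF(2)\<close> correspond to the subsets \<open>S\<close> of the vertex set \<open>V\<close>, namely to
  the positions of their ones. The bracket is therefore the sum over \<open>S \<subseteq> V\<close> of
  \<open>A\<close> to the power \<open>|V - S|\<close> times \<open>B\<close> to the power \<open>|S|\<close> times \<open>d\<close> to the nullity of the matrix
  \<open>M\<^sub>S\<close> that arises from the adjacency matrix by flipping the diagonal entries at the vertices in \<open>S\<close>
  (\<open>graph_bracket_eq_state_sum\<close>). Both recursions come from one principle: the nullity of a matrix
  does not change when an invertible principal block is replaced by its Schur complement, and over
  \<open>GF(2)\<close> the Schur complement of an adjacency matrix is again the adjacency matrix of a graph.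

  For a \<open>1 \<times> 1\<close> block with entry \<open>1\<close> at \<open>a\<close>, that graph is the local complement at \<open>a\<close>, with \<open>a\<close>
  deleted (\<open>nullity_local_compl\<close>). For a block on two adjacent vertices \<open>a, b\<close> with diagonal \<open>0, t\<close>, it
  is the pivot on \<open>ab\<close> if \<open>t = 0\<close>, and the pivot followed by the local complement at \<open>a\<close> if \<open>t = 1\<close>,
  with \<open>a\<close> and \<open>b\<close> deleted (\<open>nullity_block_pivot\<close>). Elimination only adds a matrix that depends on
  the rows and columns being removed, so it commutes with flipping the other diagonal entries, and
  these identities hold for all \<open>S\<close> simultaneously.

  Let \<open>a\<close> carry a loop, let \<open>P\<close> be the bracket of the local complement at \<open>a\<close> with \<open>a\<close> deleted, and let
  \<open>X\<close> collect the states in which the diagonal entry at \<open>a\<close> is \<open>0\<close>. Then \<open>[G] = A P + B X\<close>, while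
  removing the loop exchanges the two kinds of states and gives \<open>A X + B P\<close>; eliminating \<open>X\<close>
  gives the first recursion. For loopless adjacent \<open>a, b\<close> the three terms of the second recursion are the states
  with \<open>a, b \<notin> S\<close>, those with \<open>a \<notin> S\<close> and \<open>b \<in> S\<close>, and those with \<open>a \<in> S\<close>. For an edgeless graph, \<open>M\<^sub>S\<close>
  is diagonal with nullity \<open>|V - S|\<close>, and the sum is a binomial expansion.
\<close>

section \<open>Kernels of matrices indexed by a vertex set\<close>

text \<open>
  Indexing by vertices instead of positions in a list makes the deletion of a vertex a removal from
  \<open>V\<close>, with no renumbering. Vectors vanish outside \<open>V\<close> so that functions that agree on \<open>V\<close> are equal.
\<close>

definition null_space :: "'v set \<Rightarrow> ('v \<Rightarrow> 'v \<Rightarrow> 'r) \<Rightarrow> ('v \<Rightarrow> 'r::comm_ring_1) set" where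
  "null_space V M =
     {f. (\<forall>x. x \<notin> V \<longrightarrow> f x = 0) \<and> (\<forall>x\<in>V. (\<Sum>y\<in>V. M x y * f y) = 0)}"

text \<open>
  Over \<open>GF(2)\<close> a space of dimension \<open>k\<close> has \<open>2 ^ k\<close> elements, so the dimension can be read off the
  cardinality, and an equality of nullities only needs a bijection, linear or not.
\<close>

definition nullity :: "'v set \<Rightarrow> ('v \<Rightarrow> 'v \<Rightarrow> bit) \<Rightarrow> nat" where
  "nullity V M = (THE k. card (null_space V M) = 2 ^ k)"

lemma nullity_eqI: "card (null_space V M) = 2 ^ k \<Longrightarrow> nullity V M = k"
  unfolding nullity_def by (rule the_equality) auto

lemma null_space_cong:
  assumes "\<And>x y. x \<in> V \<Longrightarrow> y \<in> V \<Longrightarrow> M x y = N x y"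
  shows "null_space V M = null_space V N"
  using assms by (auto simp: null_space_def)

lemma nullity_cong:
  assumes "\<And>x y. x \<in> V \<Longrightarrow> y \<in> V \<Longrightarrow> M x y = N x y"
  shows "nullity V M = nullity V N"
  unfolding nullity_def using null_space_cong[of V M N] assms by simp

text \<open>
  Row \<open>a\<close> of the system determines the coordinate at \<open>a\<close> from the others; substituting it into
  the remaining rows leaves the system of the Schur complement. Forgetting that coordinate is thus
  a bijection, with inverse \<open>g \<mapsto> g(a := solve g)\<close>.
\<close>

lemma card_null_space_unit_pivot:
  fixes M :: "'v \<Rightarrow> 'v \<Rightarrow> 'r::comm_ring_1"
  assumes fin: "finite W" and a: "a \<notin> W" and aa: "M a a = 1"
  shows "card (null_space (insert a W) M) =
         card (null_space W (\<lambda>x y. M x y - M x a * M a y))"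
proof (rule bij_betw_same_card)
  let ?N = "\<lambda>x y. M x y - M x a * M a y"
  let ?solve = "\<lambda>g. - (\<Sum>y\<in>W. M a y * g y)"
  have N: "(\<Sum>y\<in>W. ?N x y * g y) = (\<Sum>y\<in>W. M x y * g y) + M x a * ?solve g" for x g
    by (simp add: left_diff_distrib sum_subtractf sum_distrib_left mult.assoc)
  have upd: "(\<Sum>y\<in>W. M x y * (g(a := c)) y) = (\<Sum>y\<in>W. M x y * g y)" for x g c
    using a by (intro sum.cong) auto
  have row: "f a = ?solve f" if "f \<in> null_space (insert a W) M" for f
    using that fin a aa by (auto simp: null_space_def eq_neg_iff_add_eq_0)
  show "bij_betw (\<lambda>f. f(a := 0)) (null_space (insert a W) M) (null_space W ?N)"
  proof (rule bij_betw_byWitness[where f' = "\<lambda>g. g(a := ?solve g)"])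
    show "\<forall>f\<in>null_space (insert a W) M. (f(a := 0))(a := ?solve (f(a := 0))) = f"
      using row upd by (auto simp: fun_eq_iff)
    show "\<forall>g\<in>null_space W ?N. (g(a := ?solve g))(a := 0) = g"
      using a by (auto simp: null_space_def fun_eq_iff)
    show "(\<lambda>f. f(a := 0)) ` null_space (insert a W) M \<subseteq> null_space W ?N"
    proof clarify
      fix f assume f: "f \<in> null_space (insert a W) M"
      have "(\<Sum>y\<in>W. ?N x y * (f(a := 0)) y) = 0" if "x \<in> W" for x
        using f that fin a row[OF f] unfolding N upd by (auto simp: null_space_def add.commute)
      then show "f(a := 0) \<in> null_space W ?N"
        using f by (auto simp: null_space_def)
    qed
    show "(\<lambda>g. g(a := ?solve g)) ` null_space W ?N \<subseteq> null_space (insert a W) M"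
    proof clarify
      fix g assume g: "g \<in> null_space W ?N"
      have "(\<Sum>y\<in>W. M x y * g y) + M x a * ?solve g = 0" if "x \<in> W" for x
        using g that unfolding null_space_def N by auto
      then show "g(a := ?solve g) \<in> null_space (insert a W) M"
        using g fin a aa unfolding null_space_def
        by (auto simp: upd add.commute simp del: fun_upd_apply) (auto simp: fun_upd_def)
    qed
  qed
qed

text \<open>
  The same elimination for the block with rows \<open>(0, 1)\<close> and \<open>(1, t)\<close>, where \<open>t = M b b\<close>. Its inverse has
  rows \<open>(-t, 1)\<close> and \<open>(1, 0)\<close>, which accounts for the three correction terms. A single-vertex pivot at
  \<open>a\<close> is impossible here, and for \<open>t = 0\<close> so is one at \<open>b\<close>; eliminating both vertices
  at once covers every \<open>t\<close>.
\<close>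

lemma card_null_space_block_pivot:
  fixes M :: "'v \<Rightarrow> 'v \<Rightarrow> 'r::comm_ring_1"
  assumes fin: "finite W" and a: "a \<notin> W" and b: "b \<notin> W" and ab: "a \<noteq> b"
    and M: "M a a = 0" "M a b = 1" "M b a = 1"
  shows "card (null_space (insert a (insert b W)) M) =
         card (null_space W
           (\<lambda>x y. M x y - M x b * M a y - M x a * M b y + M b b * M x a * M a y))"
proof (rule bij_betw_same_card)
  let ?V = "insert a (insert b W)"
  let ?N = "\<lambda>x y. M x y - M x b * M a y - M x a * M b y + M b b * M x a * M a y"
  \<comment> \<open>Row \<open>a\<close> gives the coordinate at \<open>b\<close>, and then row \<open>b\<close> gives the one at \<open>a\<close>.\<close>
  let ?q = "\<lambda>g. - (\<Sum>y\<in>W. M a y * g y)"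
  let ?p = "\<lambda>g. - (\<Sum>y\<in>W. M b y * g y) - M b b * ?q g"
  have N: "(\<Sum>y\<in>W. ?N x y * g y) = (\<Sum>y\<in>W. M x y * g y) + M x a * ?p g + M x b * ?q g" for x g
    by (simp add: algebra_simps sum_subtractf sum.distrib sum_distrib_left)
  have upd: "(\<Sum>y\<in>W. M x y * (g(a := c, b := e)) y) = (\<Sum>y\<in>W. M x y * g y)" for x g c e
    using a b by (intro sum.cong) auto
  have V: "(\<Sum>y\<in>?V. M x y * f y) = M x a * f a + M x b * f b + (\<Sum>y\<in>W. M x y * f y)" for x f
    using fin a b ab by (simp add: add.assoc)
  have rowa: "f b = ?q f" if "f \<in> null_space ?V M" for f
  proof -
    have "(\<Sum>y\<in>?V. M a y * f y) = 0" using that unfolding null_space_def by blast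
    then show ?thesis unfolding V M by (simp add: eq_neg_iff_add_eq_0)
  qed
  have rowb: "f a = ?p f" if "f \<in> null_space ?V M" for f
  proof -
    have "(\<Sum>y\<in>?V. M b y * f y) = 0" using that unfolding null_space_def by blast
    then show ?thesis unfolding V M rowa[OF that, symmetric] by (simp add: algebra_simps eq_neg_iff_add_eq_0)
  qed
  show "bij_betw (\<lambda>f. f(a := 0, b := 0)) (null_space ?V M) (null_space W ?N)"
  proof (rule bij_betw_byWitness[where f' = "\<lambda>g. g(a := ?p g, b := ?q g)"])
    show "\<forall>f\<in>null_space ?V M. (f(a := 0, b := 0))
            (a := ?p (f(a := 0, b := 0)), b := ?q (f(a := 0, b := 0))) = f"
      unfolding upd using rowa rowb by (simp add: fun_eq_iff)
    show "\<forall>g\<in>null_space W ?N. (g(a := ?p g, b := ?q g))(a := 0, b := 0) = g"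
      using a b by (auto simp: null_space_def fun_eq_iff)
    show "(\<lambda>f. f(a := 0, b := 0)) ` null_space ?V M \<subseteq> null_space W ?N"
    proof clarify
      fix f assume f: "f \<in> null_space ?V M"
      have "(\<Sum>y\<in>W. ?N x y * (f(a := 0, b := 0)) y) = 0" if x: "x \<in> W" for x
      proof -
        have "(\<Sum>y\<in>?V. M x y * f y) = 0" using f x unfolding null_space_def by blast
        then show ?thesis
          unfolding N upd rowa[OF f, symmetric] rowb[OF f, unfolded rowa[OF f, symmetric], symmetric] V
          by (simp add: algebra_simps)
      qed
      then show "f(a := 0, b := 0) \<in> null_space W ?N"
        using f by (auto simp: null_space_def)
    qed
    show "(\<lambda>g. g(a := ?p g, b := ?q g)) ` null_space W ?N \<subseteq> null_space ?V M"
    proof clarify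
      fix g assume g: "g \<in> null_space W ?N"
      let ?f = "g(a := ?p g, b := ?q g)"
      have fab: "?f a = ?p g" "?f b = ?q g" using ab by auto
      have W: "(\<Sum>y\<in>W. M x y * g y) + M x a * ?p g + M x b * ?q g = 0" if "x \<in> W" for x
        using g that unfolding null_space_def N by auto
      have "(\<Sum>y\<in>?V. M x y * ?f y) = 0" if x: "x \<in> ?V" for x
      proof -
        consider "x = a" | "x = b" | "x \<in> W" using x by auto
        then show ?thesis
        proof cases
          case 3
          then show ?thesis unfolding V upd fab using W[of x] by (simp add: add.commute add.left_commute)
        qed (unfold V upd fab, simp_all add: M algebra_simps)
      qed
      moreover have "\<forall>x. x \<notin> ?V \<longrightarrow> ?f x = 0" using g by (auto simp: null_space_def)
      ultimately show "?f \<in> null_space ?V M" unfolding null_space_def by blast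
    qed
  qed
qed

lemma card_null_space_diagonal:
  assumes "finite V"
  shows "card (null_space V (\<lambda>x y. of_bool (x = y \<and> x \<in> S) :: bit)) = 2 ^ card (V - S)"
proof -
  have eq: "(\<Sum>y\<in>V. of_bool (x = y \<and> x \<in> S) * f y) = of_bool (x \<in> S) * f x"
    if "x \<in> V" for x and f :: "_ \<Rightarrow> bit"
  proof -
    have "(\<Sum>y\<in>V. of_bool (x = y \<and> x \<in> S) * f y) =
          (\<Sum>y\<in>V. if y = x then of_bool (x \<in> S) * f x else 0)"
      by (intro sum.cong) auto
    then show ?thesis using that assms by simp
  qed
  have "null_space V (\<lambda>x y. of_bool (x = y \<and> x \<in> S) :: bit) =
        {f. \<forall>x. x \<notin> V - S \<longrightarrow> f x = 0}"
    by (auto simp: null_space_def eq simp del: mult_bit_eq_and)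
  moreover have "bij_betw (\<lambda>T x. of_bool (x \<in> T)) (Pow (V - S)) {f :: _ \<Rightarrow> bit. \<forall>x. x \<notin> V - S \<longrightarrow> f x = 0}"
  proof (rule bij_betw_byWitness[where f' = "\<lambda>f. {x. f x = 1}"])
    have "of_bool (b = 1) = b" for b :: bit by (cases "b = 1") simp_all
    then show "\<forall>f\<in>{f :: _ \<Rightarrow> bit. \<forall>x. x \<notin> V - S \<longrightarrow> f x = 0}. (\<lambda>x. of_bool (x \<in> {x. f x = 1})) = f"
      by simp
    show "(\<lambda>f. {x. f x = 1}) ` {f :: _ \<Rightarrow> bit. \<forall>x. x \<notin> V - S \<longrightarrow> f x = 0} \<subseteq> Pow (V - S)"
    proof clarify
      fix f :: "_ \<Rightarrow> bit" and x
      assume f: "\<forall>x. x \<notin> V - S \<longrightarrow> f x = 0" and "f x = 1"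
      then have "f x \<noteq> 0" by simp
      then show "x \<in> V - S" using f by blast
    qed
  qed auto
  ultimately show ?thesis
    using assms by (simp add: bij_betw_same_card[symmetric] card_Pow)
qed

lemma nullity_diagonal:
  "finite V \<Longrightarrow> nullity V (\<lambda>x y. of_bool (x = y \<and> x \<in> S)) = card (V - S)"
  by (intro nullity_eqI card_null_space_diagonal)

lemma UNIV_bit_eq: "(UNIV :: bit set) = {0, 1}"
  using bit_not_one_iff by blast

text \<open>Coordinates with respect to a basis identify the kernel with the functions on that basis.\<close>

lemma (in kernel) card_mat_kernel:
  assumes fin: "finite (UNIV :: 'a set)"
  shows "card (mat_kernel A) = card (UNIV :: 'a set) ^ dim"
proof -
  \<comment> \<open>The kernel is finite, so it is a finite generating set of itself.\<close>
  have covered: "carrier_vec nc \<subseteq> vec nc ` ({..<nc} \<rightarrow>\<^sub>E (UNIV :: 'a set))"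
  proof
    fix v :: "'a vec" assume "v \<in> carrier_vec nc"
    then have "v = vec nc (restrict (\<lambda>i. v $ i) {..<nc})" by (intro eq_vecI) auto
    moreover have "restrict (\<lambda>i. v $ i) {..<nc} \<in> {..<nc} \<rightarrow>\<^sub>E UNIV" by auto
    ultimately show "v \<in> vec nc ` ({..<nc} \<rightarrow>\<^sub>E UNIV)" by (metis imageI)
  qed
  have "finite (vec nc ` ({..<nc} \<rightarrow>\<^sub>E (UNIV :: 'a set)))"
    using fin by (intro finite_imageI finite_PiE) auto
  then have "finite (mat_kernel A)"
    by (rule finite_subset[OF subset_trans[OF mat_kernel_carrier[OF A] covered]])
  moreover have "span (mat_kernel A) = mat_kernel A"
    using Ker.in_own_span[of "mat_kernel A"] Ker.span_is_subset2[of "mat_kernel A"] by auto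
  ultimately have "Ker.fin_dim"
    unfolding Ker.fin_dim_def by (intro exI[of _ "mat_kernel A"] conjI) auto
  then obtain b where b: "finite b" "Ker.basis b" using Ker.finite_basis_exists by blast
  have bsub: "b \<subseteq> mat_kernel A" using b(2) unfolding Ker.basis_def by auto
  have unique: "\<forall>v\<in>mat_kernel A. \<exists>!a. a \<in> b \<rightarrow>\<^sub>E UNIV \<and> lincomb a b = v"
    using Ker.basis_criterion[OF b(1) bsub] b(2) by auto
  have closed: "lincomb a b \<in> mat_kernel A" for a
    using Ker.lincomb_closed[OF bsub, of a] by auto
  have "bij_betw (\<lambda>a. lincomb a b) (b \<rightarrow>\<^sub>E UNIV) (mat_kernel A)"
    unfolding bij_betw_def inj_on_def
  proof (intro conjI ballI impI)
    fix f g assume "f \<in> b \<rightarrow>\<^sub>E UNIV" "g \<in> b \<rightarrow>\<^sub>E UNIV" "lincomb f b = lincomb g b"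
    then show "f = g" using unique closed by metis
  next
    show "(\<lambda>a. lincomb a b) ` (b \<rightarrow>\<^sub>E UNIV) = mat_kernel A"
      using unique closed by (auto simp: image_iff)
  qed
  from bij_betw_same_card[OF this] show ?thesis
    using b by (simp add: card_funcsetE Ker.dim_basis)
qed

lemma sum_nth_distinct:
  "distinct vs \<Longrightarrow> (\<Sum>y\<in>set vs. h y) = (\<Sum>j<length vs. h (vs ! j))"
  by (rule sum.reindex_bij_betw[OF bij_betw_nth, symmetric]) auto

definition matrix_of :: "'v list \<Rightarrow> ('v \<Rightarrow> 'v \<Rightarrow> 'r) \<Rightarrow> 'r mat" where
  "matrix_of vs M = mat (length vs) (length vs) (\<lambda>(i, j). M (vs ! i) (vs ! j))"

lemma matrix_of_carrier [simp]: "matrix_of vs M \<in> carrier_mat (length vs) (length vs)"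
  by (simp add: matrix_of_def)

lemma card_mat_kernel_matrix_of:
  assumes dist: "distinct vs"
  shows "card (mat_kernel (matrix_of vs M)) = card (null_space (set vs) M)"
proof (rule bij_betw_same_card[symmetric])
  let ?n = "length vs"
  let ?vec = "\<lambda>f. vec ?n (\<lambda>i. f (vs ! i))"
  have inv: "\<exists>i<?n. vs ! i = x \<and> (THE i. i < ?n \<and> vs ! i = x) = i" if "x \<in> set vs" for x
  proof -
    from that obtain i where i: "i < ?n" "vs ! i = x" by (auto simp: in_set_conv_nth)
    then have "(THE i. i < ?n \<and> vs ! i = x) = i"
      using dist by (intro the_equality) (auto simp: nth_eq_iff_index_eq)
    with i show ?thesis by blast
  qed
  have mult: "(matrix_of vs M *\<^sub>v ?vec f) $ i = (\<Sum>y\<in>set vs. M (vs ! i) y * f y)" if "i < ?n" for f i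
    using that by (simp add: matrix_of_def scalar_prod_def sum_nth_distinct[OF dist] lessThan_atLeast0)
  have ker: "?vec f \<in> mat_kernel (matrix_of vs M) \<longleftrightarrow> (\<forall>x\<in>set vs. (\<Sum>y\<in>set vs. M x y * f y) = 0)" for f
  proof -
    have "?vec f \<in> mat_kernel (matrix_of vs M) \<longleftrightarrow>
          (\<forall>i<?n. (matrix_of vs M *\<^sub>v ?vec f) $ i = 0)"
      unfolding mat_kernel[OF matrix_of_carrier] by (auto simp: matrix_of_def vec_eq_iff)
    also have "\<dots> \<longleftrightarrow> (\<forall>i<?n. (\<Sum>y\<in>set vs. M (vs ! i) y * f y) = 0)"
      using mult by auto
    finally show ?thesis by (simp add: all_set_conv_all_nth)
  qed
  show "bij_betw ?vec (null_space (set vs) M) (mat_kernel (matrix_of vs M))"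
    unfolding bij_betw_def
  proof
    show "inj_on ?vec (null_space (set vs) M)"
    proof (rule inj_onI, rule ext)
      fix f g x assume fg: "f \<in> null_space (set vs) M" "g \<in> null_space (set vs) M" "?vec f = ?vec g"
      show "f x = g x"
      proof (cases "x \<in> set vs")
        case True
        then obtain i where "i < ?n" "vs ! i = x" by (auto simp: in_set_conv_nth)
        then show ?thesis using arg_cong[OF fg(3), of "\<lambda>v. v $ i"] by simp
      qed (use fg in \<open>auto simp: null_space_def\<close>)
    qed
    show "?vec ` null_space (set vs) M = mat_kernel (matrix_of vs M)"
    proof (intro equalityI subsetI)
      fix v assume v: "v \<in> mat_kernel (matrix_of vs M)"
      then have dv: "v \<in> carrier_vec ?n" using mat_kernel_carrier[OF matrix_of_carrier] by blast
      define f where "f = (\<lambda>x. if x \<in> set vs then v $ (THE i. i < ?n \<and> vs ! i = x) else 0)"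
      have "f (vs ! i) = v $ i" if "i < ?n" for i
        using inv[of "vs ! i"] that dist unfolding f_def by (auto simp: nth_eq_iff_index_eq)
      then have "v = ?vec f" using dv by (intro eq_vecI) auto
      moreover from this have "f \<in> null_space (set vs) M"
        using v ker[of f] by (auto simp: null_space_def) (auto simp: f_def)
      ultimately show "v \<in> ?vec ` null_space (set vs) M" by blast
    qed (auto simp: null_space_def ker)
  qed
qed

text \<open>
  The right-hand side depends on the vertex list only through its set of elements; this is why the
  bracket does not depend on the ordering.
\<close>

lemma kernel_dim_matrix_of:
  assumes "distinct vs"
  shows "kernel_dim (matrix_of vs M) = nullity (set vs) M"
proof -
  interpret kernel "length vs" "length vs" "matrix_of vs M"
    by unfold_locales simp
  have "card (null_space (set vs) M) = 2 ^ kernel_dim (matrix_of vs M)"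
    using card_mat_kernel card_mat_kernel_matrix_of[OF assms, of M] by (simp add: UNIV_bit_eq numeral_2_eq_2)
  then show ?thesis by (rule nullity_eqI[symmetric])
qed

section \<open>The bracket as a sum over vertex subsets\<close>

definition diag_indicator :: "'v set \<Rightarrow> 'v \<Rightarrow> 'v \<Rightarrow> bit" where
  "diag_indicator S x y = of_bool (x = y \<and> x \<in> S)"

text \<open>
  Every column is zero or a unit vector, so the unit vectors among the columns form a maximal
  independent set: a larger one would contain the zero vector.
\<close>

lemma rank_diag_indicator:
  assumes dist: "distinct vs" and S: "S \<subseteq> set vs"
  shows "vec_space.rank (length vs) (matrix_of vs (diag_indicator S)) = card S"
proof -
  let ?n = "length vs" and ?D = "matrix_of vs (diag_indicator S)"
  interpret vec_space "TYPE(bit)" ?n .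
  define I where "I = {i. i < ?n \<and> vs ! i \<in> S}"
  define U :: "bit vec set" where "U = unit_vec ?n ` I"
  have col: "col ?D j = (if j \<in> I then unit_vec ?n j else 0\<^sub>v ?n)" if "j < ?n" for j
    using that dist by (intro eq_vecI)
      (auto simp: matrix_of_def diag_indicator_def I_def nth_eq_iff_index_eq unit_vec_def)
  have cols: "set (cols ?D) = (\<lambda>j. if j \<in> I then unit_vec ?n j else 0\<^sub>v ?n) ` {..<?n}"
    using col by (auto simp: cols_def matrix_of_def lessThan_atLeast0)
  have indpt: "lin_indpt U"
    using unit_vecs_basis unfolding basis_def
    by (rule subset_li_is_li[OF conjunct1]) (auto simp: U_def I_def unit_vecs_def)
  have "maximal U (\<lambda>T. T \<subseteq> set (cols ?D) \<and> lin_indpt T)"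
    unfolding maximal_def
  proof (intro conjI allI impI indpt)
    show "U \<subseteq> set (cols ?D)" unfolding cols U_def by (auto simp: I_def image_iff)
    fix T assume T: "U \<subseteq> T \<and> T \<subseteq> set (cols ?D) \<and> lin_indpt T"
    then have "T \<subseteq> carrier_vec ?n" using cols_dim[of ?D] by (auto simp: matrix_of_def)
    then have "0\<^sub>v ?n \<notin> T" using vs_zero_lin_dep[of T] T by auto
    then show "T = U" using T unfolding cols U_def by (auto split: if_splits)
  qed
  then have "rank ?D = card U" by (intro rank_card_indpt[of _ ?n]) auto
  also have "card U = card I"
    unfolding U_def by (intro card_image) (auto simp: inj_on_def I_def unit_vec_eq)
  also have "card I = card ((!) vs ` I)"
    using dist by (intro card_image[symmetric]) (auto simp: inj_on_def I_def nth_eq_iff_index_eq)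
  also have "(!) vs ` I = S"
    using S by (fastforce simp: I_def in_set_conv_nth)
  finally show ?thesis .
qed

lemma bij_betw_diagonal_mats:
  assumes dist: "distinct vs"
  shows "bij_betw (\<lambda>S. matrix_of vs (diag_indicator S)) (Pow (set vs)) (diagonal_mats (length vs))"
proof (rule bij_betw_byWitness[where f' = "\<lambda>D. {vs ! i |i. i < length vs \<and> D $$ (i, i) = 1}"])
  let ?n = "length vs"
  show "\<forall>S\<in>Pow (set vs).
      {vs ! i |i. i < ?n \<and> matrix_of vs (diag_indicator S) $$ (i, i) = 1} = S"
    by (force simp: matrix_of_def diag_indicator_def in_set_conv_nth)
  show "\<forall>D\<in>diagonal_mats ?n.
      matrix_of vs (diag_indicator {vs ! i |i. i < ?n \<and> D $$ (i, i) = 1}) = D"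
  proof
    fix D assume D: "D \<in> diagonal_mats ?n"
    show "matrix_of vs (diag_indicator {vs ! i |i. i < ?n \<and> D $$ (i, i) = 1}) = D"
    proof (rule eq_matI)
      fix i j assume "i < dim_row D" "j < dim_col D"
      then have ij: "i < ?n" "j < ?n" using D by (auto simp: diagonal_mats_def)
      have "D $$ (i, j) = 0" if "i \<noteq> j"
        using D ij that by (auto simp: diagonal_mats_def diagonal_mat_def)
      moreover have "(\<exists>k. vs ! j = vs ! k \<and> k < ?n \<and> D $$ (k, k) = 1) \<longleftrightarrow> D $$ (j, j) = 1"
        using ij dist by (auto simp: nth_eq_iff_index_eq)
      ultimately show "matrix_of vs (diag_indicator {vs ! i |i. i < ?n \<and> D $$ (i, i) = 1}) $$ (i, j) = D $$ (i, j)"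
        using ij dist by (auto simp: matrix_of_def diag_indicator_def nth_eq_iff_index_eq)
    qed (use D in \<open>auto simp: diagonal_mats_def matrix_of_def\<close>)
  qed
  show "(\<lambda>S. matrix_of vs (diag_indicator S)) ` Pow (set vs) \<subseteq> diagonal_mats ?n"
    using dist by (auto simp: diagonal_mats_def diagonal_mat_def matrix_of_def diag_indicator_def nth_eq_iff_index_eq)
qed auto

definition state_matrix :: "'v graph \<Rightarrow> 'v set \<Rightarrow> 'v \<Rightarrow> 'v \<Rightarrow> bit" where
  "state_matrix G S x y = of_bool (adj G x y) + of_bool (x = y \<and> x \<in> S)"

definition state_sum :: "'v set \<Rightarrow> ('v set \<Rightarrow> nat) \<Rightarrow> laurent" where
  "state_sum V k = (\<Sum>S\<in>Pow V. var_A ^ card (V - S) * var_B ^ card S * var_d ^ k S)"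

lemma state_sum_cong:
  "(\<And>S. S \<subseteq> V \<Longrightarrow> k S = l S) \<Longrightarrow> state_sum V k = state_sum V l"
  unfolding state_sum_def by (intro sum.cong) auto

lemma bracket_wrt_eq_state_sum:
  assumes dist: "distinct vs"
  shows "bracket_wrt G vs = state_sum (set vs) (\<lambda>S. nullity (set vs) (state_matrix G S))"
proof -
  let ?D = "\<lambda>S. matrix_of vs (diag_indicator S)"
  have adj: "adj_mat G vs + ?D S = matrix_of vs (state_matrix G S)" for S
    by (rule eq_matI) (auto simp: adj_mat_def matrix_of_def state_matrix_def diag_indicator_def)
  have "bracket_wrt G vs =
      (\<Sum>S\<in>Pow (set vs). var_A ^ kernel_dim (?D S) * var_B ^ vec_space.rank (length vs) (?D S) *
        var_d ^ kernel_dim (adj_mat G vs + ?D S))"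
    unfolding bracket_wrt_def by (rule sum.reindex_bij_betw[OF bij_betw_diagonal_mats[OF dist], symmetric])
  also have "\<dots> = state_sum (set vs) (\<lambda>S. nullity (set vs) (state_matrix G S))"
    unfolding state_sum_def
  proof (intro sum.cong refl)
    fix S assume "S \<in> Pow (set vs)"
    then have S: "S \<subseteq> set vs" by simp
    have "kernel_dim (?D S) = card (set vs - S)"
      unfolding kernel_dim_matrix_of[OF dist] diag_indicator_def
      by (rule nullity_diagonal) simp
    then show "var_A ^ kernel_dim (?D S) * var_B ^ vec_space.rank (length vs) (?D S) *
        var_d ^ kernel_dim (adj_mat G vs + ?D S) =
        var_A ^ card (set vs - S) * var_B ^ card S * var_d ^ nullity (set vs) (state_matrix G S)"
      unfolding rank_diag_indicator[OF dist S] adj kernel_dim_matrix_of[OF dist] by simp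
  qed
  finally show ?thesis .
qed

lemma graph_bracket_eq_state_sum:
  assumes "finite (verts G)"
  shows "graph_bracket G = state_sum (verts G) (\<lambda>S. nullity (verts G) (state_matrix G S))"
proof -
  let ?vs = "SOME vs. distinct vs \<and> set vs = verts G"
  have "distinct ?vs \<and> set ?vs = verts G"
    using someI_ex[of "\<lambda>vs. distinct vs \<and> set vs = verts G"] finite_distinct_list[OF assms] by blast
  then show ?thesis
    unfolding graph_bracket_def using bracket_wrt_eq_state_sum[of ?vs G] by simp
qed

text \<open>Sorting the states by whether they contain \<open>a\<close> is the first step of both recursions.\<close>

lemma state_sum_insert:
  assumes fin: "finite W" and a: "a \<notin> W"
  shows "state_sum (insert a W) k =
         var_A * state_sum W k + var_B * state_sum W (\<lambda>S. k (insert a S))"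
proof -
  let ?t = "\<lambda>S. var_A ^ card (insert a W - S) * var_B ^ card S * var_d ^ k S"
  have without: "card (insert a W - S) = Suc (card (W - S))" if "S \<subseteq> W" for S
  proof -
    have "insert a W - S = insert a (W - S)" using that a by auto
    then show ?thesis using fin a by simp
  qed
  have added: "W - insert a S = W - S" "card (insert a S) = Suc (card S)" if "S \<subseteq> W" for S
    using that a finite_subset[OF that fin] by (auto intro!: card_insert_disjoint)
  have "state_sum (insert a W) k = (\<Sum>S\<in>Pow W. ?t S) + (\<Sum>S\<in>insert a ` Pow W. ?t S)"
    unfolding state_sum_def Pow_insert using fin a by (intro sum.union_disjoint) auto
  also have "(\<Sum>S\<in>insert a ` Pow W. ?t S) = (\<Sum>S\<in>Pow W. ?t (insert a S))"
    using a by (subst sum.reindex) (auto simp: inj_on_def insert_ident)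
  also have "\<dots> = var_B * state_sum W (\<lambda>S. k (insert a S))"
    unfolding state_sum_def sum_distrib_left
    by (intro sum.cong refl) (simp add: added algebra_simps)
  also have "(\<Sum>S\<in>Pow W. ?t S) = var_A * state_sum W k"
    unfolding state_sum_def sum_distrib_left
    by (intro sum.cong refl) (simp add: without algebra_simps)
  finally show ?thesis .
qed

section \<open>Local complements and pivots as Schur complements\<close>

lemma adj_commute: "adj G x y \<longleftrightarrow> adj G y x"
  by (simp add: adj_def insert_commute)

lemma adj_toggle:
  "adj (toggle G T) x y \<longleftrightarrow> adj G x y \<noteq> ({x, y} \<in> T)"
  by (auto simp: adj_def toggle_def)

lemma adj_local_compl:
  "adj (local_compl G a) x y \<longleftrightarrow>
   adj G x y \<noteq> (x \<noteq> a \<and> y \<noteq> a \<and> adj G x a \<and> adj G y a)"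
  unfolding local_compl_def adj_toggle by (auto simp: doubleton_eq_iff)

text \<open>
  The condition in the definition of the pivot mentions an ordered pair, while the pair that is
  toggled is unordered. Taken together, the two orders say that exactly one of the products
  \<open>(x ~ a)(y ~ b)\<close> and \<open>(x ~ b)(y ~ a)\<close> of adjacencies is \<open>1\<close>, that is, their sum over \<open>GF(2)\<close> is \<open>1\<close>;
  this is the form in which the Schur complement produces it.
\<close>

lemma adj_pivot:
  "adj (pivot G a b) x y \<longleftrightarrow>
   adj G x y \<noteq> (x \<notin> {a, b} \<and> y \<notin> {a, b} \<and>
     (adj G x a \<and> adj G y b) \<noteq> (adj G x b \<and> adj G y a))"
  unfolding pivot_def adj_toggle by (auto simp: doubleton_eq_iff)

lemma adj_delete_vertex:
  "adj (delete_vertex G a) x y \<longleftrightarrow> adj G x y \<and> x \<noteq> a \<and> y \<noteq> a"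
  by (auto simp: adj_def delete_vertex_def)

lemma adj_remove_loop:
  "adj (remove_loop G a) x y \<longleftrightarrow> adj G x y \<and> \<not> (x = a \<and> y = a)"
  by (auto simp: adj_def remove_loop_def doubleton_eq_iff)

lemma verts_simps [simp]:
  "verts (local_compl G a) = verts G" "verts (pivot G a b) = verts G"
  "verts (delete_vertex G a) = verts G - {a}" "verts (remove_loop G a) = verts G"
  by (simp_all add: local_compl_def pivot_def toggle_def delete_vertex_def remove_loop_def)

lemma finite_graphD:
  assumes "finite_graph G"
  shows "finite (verts G)" "adj G x y \<Longrightarrow> x \<in> verts G"
  using assms by (auto simp: finite_graph_def adj_def doubleton_eq_iff dest!: bspec)

text \<open>
  Subtracting \<open>M x a * M a y\<close> toggles exactly the pairs of neighbours of \<open>a\<close>. The assumption says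
  that the diagonal entry at \<open>a\<close> is \<open>1\<close>, from a loop or from \<open>S\<close> but not from both.
\<close>

lemma nullity_local_compl:
  assumes W: "finite W" "a \<notin> W" "S \<subseteq> insert a W" and loop: "adj G a a \<noteq> (a \<in> S)"
  shows "nullity (insert a W) (state_matrix G S) =
         nullity W (state_matrix (delete_vertex (local_compl G a) a) (S - {a}))"
proof -
  have "nullity (insert a W) (state_matrix G S) =
        nullity W (\<lambda>x y. state_matrix G S x y - state_matrix G S x a * state_matrix G S a y)"
    unfolding nullity_def using W loop
    by (subst card_null_space_unit_pivot) (auto simp: state_matrix_def)
  also have "\<dots> = nullity W (state_matrix (delete_vertex (local_compl G a) a) (S - {a}))"
    using W by (intro nullity_cong)
      (auto simp: state_matrix_def adj_delete_vertex adj_local_compl adj_commute[of G a])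
  finally show ?thesis .
qed

text \<open>
  The two mixed correction terms of the block elimination are the toggles of the pivot. The term
  \<open>M b b * M x a * M a y\<close> is present if and only if \<open>b \<in> S\<close> and toggles the pairs of neighbours of \<open>a\<close>;
  since pivoting leaves the neighbours of \<open>a\<close> unchanged, it is a local complement of the pivot.
\<close>

lemma nullity_block_pivot:
  assumes W: "finite W" "a \<notin> W" "b \<notin> W" "S \<subseteq> insert b W" and ab: "a \<noteq> b" "adj G a b"
    and loops: "\<not> adj G a a" "\<not> adj G b b"
  shows "nullity (insert a (insert b W)) (state_matrix G S) =
         nullity W (state_matrix (delete_vertex (delete_vertex
           (if b \<in> S then local_compl (pivot G a b) a else pivot G a b) a) b) (S - {b}))"
proof -
  let ?M = "state_matrix G S"
  have "nullity (insert a (insert b W)) ?M =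
        nullity W (\<lambda>x y. ?M x y - ?M x b * ?M a y - ?M x a * ?M b y + ?M b b * ?M x a * ?M a y)"
    unfolding nullity_def using W ab loops
    by (subst card_null_space_block_pivot) (auto simp: state_matrix_def adj_commute[of G b a])
  also have "\<dots> = nullity W (state_matrix (delete_vertex (delete_vertex
           (if b \<in> S then local_compl (pivot G a b) a else pivot G a b) a) b) (S - {b}))"
  proof (intro nullity_cong)
    fix x y assume xy: "x \<in> W" "y \<in> W"
    then have ne: "x \<noteq> a" "x \<noteq> b" "y \<noteq> a" "y \<noteq> b" using W by auto
    let ?H = "if b \<in> S then local_compl (pivot G a b) a else pivot G a b"
    \<comment> \<open>Flipped diagonal entries outside \<open>{a, b}\<close> contribute the same summand to both sides.\<close>
    define D :: bit where "D = of_bool (x = y \<and> x \<in> S)"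
    have lhs: "?M x y = of_bool (adj G x y) + D"
      "?M x a = of_bool (adj G x a)" "?M x b = of_bool (adj G x b)"
      "?M a y = of_bool (adj G y a)" "?M b y = of_bool (adj G y b)" "?M b b = of_bool (b \<in> S)"
      using ne loops adj_commute[of G a y] adj_commute[of G b y]
      by (simp_all add: state_matrix_def D_def)
    have "adj ?H x y \<longleftrightarrow> (adj G x y \<noteq> ((adj G x a \<and> adj G y b) \<noteq> (adj G x b \<and> adj G y a))) \<noteq>
        (b \<in> S \<and> adj G x a \<and> adj G y a)"
      using ne by (simp add: adj_local_compl adj_pivot)
    then have rhs: "state_matrix (delete_vertex (delete_vertex ?H a) b) (S - {b}) x y =
        of_bool ((adj G x y \<noteq> ((adj G x a \<and> adj G y b) \<noteq> (adj G x b \<and> adj G y a))) \<noteq>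
          (b \<in> S \<and> adj G x a \<and> adj G y a)) + D"
      using ne by (simp add: state_matrix_def adj_delete_vertex D_def)
    show "?M x y - ?M x b * ?M a y - ?M x a * ?M b y + ?M b b * ?M x a * ?M a y =
        state_matrix (delete_vertex (delete_vertex ?H a) b) (S - {b}) x y"
      unfolding lhs rhs
      by (cases "adj G x y"; cases "adj G x a"; cases "adj G x b"; cases "adj G y a";
          cases "adj G y b"; cases "b \<in> S"; cases "D = 0"; simp)
  qed
  finally show ?thesis .
qed

section \<open>The recursion\<close>

lemma graph_bracket_loop:
  assumes G: "finite_graph G" and loop: "adj G a a"
  shows "graph_bracket G =
           inv_A * var_B * graph_bracket (remove_loop G a) +
           (var_A - inv_A * var_B ^ 2) * graph_bracket (delete_vertex (local_compl G a) a)"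
proof -
  define W where "W = verts G - {a}"
  have V: "verts G = insert a W" and W: "finite W" "a \<notin> W"
    using finite_graphD[OF G] loop by (auto simp: W_def)
  let ?L = "delete_vertex (local_compl G a) a" and ?R = "remove_loop G a"
  let ?P = "graph_bracket ?L"
  define X where "X = state_sum W (\<lambda>S. nullity (insert a W) (state_matrix ?R S))"
  have P: "?P = state_sum W (\<lambda>S. nullity W (state_matrix ?L S))"
    using graph_bracket_eq_state_sum[of ?L] W by (simp add: V)
  have entry1: "nullity (insert a W) (state_matrix G S) = nullity W (state_matrix ?L S)"
    if "S \<subseteq> W" for S
    using nullity_local_compl[of W a S G] that W loop by (auto simp: Diff_insert0 subset_insertI2)
  \<comment> \<open>Removing the loop and adding \<open>a\<close> to the state have the same effect on the matrix.\<close>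
  have swap0: "nullity (insert a W) (state_matrix G (insert a S)) =
      nullity (insert a W) (state_matrix ?R S)" if "S \<subseteq> W" for S
    using that W loop by (intro nullity_cong) (auto simp: state_matrix_def adj_remove_loop)
  have "nullity (insert a W) (state_matrix ?R (insert a S)) =
      nullity (insert a W) (state_matrix G S)" if "S \<subseteq> W" for S
    using that W loop by (intro nullity_cong) (auto simp: state_matrix_def adj_remove_loop)
  then have swap1: "nullity (insert a W) (state_matrix ?R (insert a S)) =
      nullity W (state_matrix ?L S)" if "S \<subseteq> W" for S
    using entry1 that by simp
  have G: "graph_bracket G = var_A * ?P + var_B * X"
    using graph_bracket_eq_state_sum[of G] W
    by (simp add: V state_sum_insert P X_def state_sum_cong[OF entry1] state_sum_cong[OF swap0])
  have R: "graph_bracket ?R = var_A * X + var_B * ?P"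
    using graph_bracket_eq_state_sum[of ?R] W
    by (simp add: V state_sum_insert P X_def state_sum_cong[OF swap1])
  have "inv_A * var_B * (var_A * X + var_B * ?P) + (var_A - inv_A * var_B ^ 2) * ?P =
        (var_A * inv_A) * var_B * X + var_A * ?P"
    by (simp add: algebra_simps power2_eq_square)
  then show ?thesis unfolding G R by (simp add: var_A_inv_A)
qed

lemma graph_bracket_pivot:
  assumes G: "finite_graph G" and ab: "a \<noteq> b" "adj G a b" and loops: "\<not> adj G a a" "\<not> adj G b b"
  shows "graph_bracket G =
           var_A ^ 2 * graph_bracket (delete_vertex (delete_vertex (pivot G a b) a) b) +
           var_A * var_B *
             graph_bracket (delete_vertex (delete_vertex (local_compl (pivot G a b) a) a) b) +
           var_B * graph_bracket (delete_vertex (local_compl G a) a)"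
proof -
  define W where "W = verts G - {a, b}"
  have "a \<in> verts G" "b \<in> verts G"
    using finite_graphD(2)[OF G, of a b] finite_graphD(2)[OF G, of b a] ab adj_commute[of G] by auto
  then have V: "verts G = insert a (insert b W)" and W: "finite W" "a \<notin> W" "b \<notin> W"
    using finite_graphD[OF G] by (auto simp: W_def)
  have V': "insert a (insert b W) - {a} = insert b W" "insert b W - {b} = W"
    using W ab by auto
  let ?P = "delete_vertex (delete_vertex (pivot G a b) a) b"
  let ?Q = "delete_vertex (delete_vertex (local_compl (pivot G a b) a) a) b"
  let ?L = "delete_vertex (local_compl G a) a"
  let ?k = "\<lambda>S. nullity (insert a (insert b W)) (state_matrix G S)"
  have P: "?k S = nullity W (state_matrix ?P S)" if "S \<subseteq> W" for S
  proof -
    have "b \<notin> S" "S - {b} = S" "S \<subseteq> insert b W" using that W by auto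
    then show ?thesis using nullity_block_pivot[of W a b S G] W ab loops by simp
  qed
  have Q: "?k (insert b S) = nullity W (state_matrix ?Q S)" if "S \<subseteq> W" for S
  proof -
    have "insert b S - {b} = S" "insert b S \<subseteq> insert b W" using that W by auto
    then show ?thesis using nullity_block_pivot[of W a b "insert b S" G] W ab loops by simp
  qed
  have L: "?k (insert a S) = nullity (insert b W) (state_matrix ?L S)" if "S \<subseteq> insert b W" for S
  proof -
    have "insert a S - {a} = S" "insert a S \<subseteq> insert a (insert b W)" using that W ab by auto
    then show ?thesis using nullity_local_compl[of "insert b W" a "insert a S" G] W ab loops by simp
  qed
  have "graph_bracket G = state_sum (insert a (insert b W)) ?k"
    using graph_bracket_eq_state_sum[of G] W by (simp add: V)
  also have "\<dots> = var_A * (var_A * state_sum W ?k + var_B * state_sum W (\<lambda>S. ?k (insert b S))) +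
      var_B * state_sum (insert b W) (\<lambda>S. ?k (insert a S))"
    using W ab by (simp add: state_sum_insert[of "insert b W" a] state_sum_insert[of W b ?k])
  also have "state_sum W ?k = graph_bracket ?P"
    using graph_bracket_eq_state_sum[of ?P] W by (simp add: V V' state_sum_cong[OF P])
  also have "state_sum W (\<lambda>S. ?k (insert b S)) = graph_bracket ?Q"
    using graph_bracket_eq_state_sum[of ?Q] W by (simp add: V V' state_sum_cong[OF Q])
  also have "state_sum (insert b W) (\<lambda>S. ?k (insert a S)) = graph_bracket ?L"
    using graph_bracket_eq_state_sum[of ?L] W by (simp add: V V' state_sum_cong[OF L])
  finally show ?thesis by (simp add: algebra_simps power2_eq_square)
qed

lemma graph_bracket_edgeless:
  assumes V: "finite V"
  shows "graph_bracket (edgeless_graph V) = (var_A * var_d + var_B) ^ card V"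
proof -
  have k: "nullity V (state_matrix (edgeless_graph V) S) = card (V - S)" for S
    unfolding nullity_diagonal[OF V, symmetric]
    by (intro nullity_cong) (auto simp: state_matrix_def adj_def edgeless_graph_def)
  have "graph_bracket (edgeless_graph V) = state_sum V (\<lambda>S. card (V - S))"
    using graph_bracket_eq_state_sum[of "edgeless_graph V"] V k by (simp add: edgeless_graph_def)
  also have "\<dots> = (\<Prod>x\<in>V. var_B + var_A * var_d)"
    unfolding state_sum_def prod_add[OF V]
    by (intro sum.cong refl) (simp add: power_mult_distrib algebra_simps)
  finally show ?thesis by (simp add: add.commute)
qed

theorem theorem1:
  shows
    "(\<forall>(G :: 'a graph) a. finite_graph G \<and> adj G a a \<longrightarrow>
        graph_bracket G =
          inv_A * var_B * graph_bracket (remove_loop G a) +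
          (var_A - inv_A * var_B ^ 2) * graph_bracket (delete_vertex (local_compl G a) a))
     \<and>
     (\<forall>(G :: 'a graph) a b.
        finite_graph G \<and> a \<noteq> b \<and> adj G a b \<and> \<not> adj G a a \<and> \<not> adj G b b \<longrightarrow>
        graph_bracket G =
          var_A ^ 2 * graph_bracket (delete_vertex (delete_vertex (pivot G a b) a) b) +
          var_A * var_B *
            graph_bracket (delete_vertex (delete_vertex (local_compl (pivot G a b) a) a) b) +
          var_B * graph_bracket (delete_vertex (local_compl G a) a))
     \<and>
     graph_bracket (edgeless_graph ({} :: 'a set)) = 1
     \<and>
     (\<forall>n\<ge>1. \<forall>V :: 'a set. finite V \<and> card V = n \<longrightarrow>
        graph_bracket (edgeless_graph V) = (var_A * var_d + var_B) ^ n)"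
  using graph_bracket_loop graph_bracket_pivot graph_bracket_edgeless[of "{}"] graph_bracket_edgeless
  by auto

end
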